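(* Let $T$ be a tree and let $l\colon V(T)\to[0,\infty)$ be a non-degenerate labeling. Then the following are equivalent: (1) the ultrametric space $(V(T), d_l)$ is compact; (2) $T$ is rayless, for every $\varepsilon>0$ the set $V_\varepsilon=\{v\in V(T)\colon l(v)\ge\varepsilon\}$ is finite, and $\delta_T(v)<\infty$ holds for every $v\in V(T)$ with $l(v)>0$.
   Context: A tree is a connected acyclic graph with nonempty vertex set; $\delta_T(v)$ is the degree of $v$ (cardinality of the set of adjacent vertices). A ray is an infinite graph with pairwise distinct vertices $x_1,x_2,\ldots$ and edges $\{x_n,x_{n+1}\}$; a graph is rayless if it contains no ray. For a labeling $l\colon V(T)\to[0,\infty)$ define $d_l(u,u)=0$ and, for $u\neq v$, $d_l(u,v)=\max_{w\in V(P)} l(w)$, where $P$ is the unique path joining $u$ and $v$ in $T$. The labeling is non-degenerate if $\max\{l(u),l(v)\}>0$ for every edge $\{u,v\}$; then $d_l$ is an ultrametric. *)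

theory Defs
  imports "HOL-Analysis.Analysis" "HOL-Library.Extended_Nat"
begin

text \<open>
  Undirected simple graphs, possibly infinite, given by a vertex set \<open>V\<close> and a set \<open>E\<close> of
  two-element subsets of \<open>V\<close>.
\<close>

definition simple_graph :: "'a set \<Rightarrow> 'a set set \<Rightarrow> bool" where
  "simple_graph V E \<longleftrightarrow> (\<forall>e\<in>E. e \<subseteq> V \<and> card e = 2)"

definition graph_path :: "'a set \<Rightarrow> 'a set set \<Rightarrow> 'a \<Rightarrow> 'a list \<Rightarrow> 'a \<Rightarrow> bool" where
  "graph_path V E u p v \<longleftrightarrow>
     p \<noteq> [] \<and> hd p = u \<and> last p = v \<and> set p \<subseteq> V \<and> distinct p \<and>
     successively (\<lambda>x y. {x, y} \<in> E) p"

definition connected_graph :: "'a set \<Rightarrow> 'a set set \<Rightarrow> bool" where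
  "connected_graph V E \<longleftrightarrow> (\<forall>u\<in>V. \<forall>v\<in>V. \<exists>p. graph_path V E u p v)"

text \<open>A cycle is listed without repeating its initial vertex at the end.\<close>

definition graph_cycle :: "'a set \<Rightarrow> 'a set set \<Rightarrow> 'a list \<Rightarrow> bool" where
  "graph_cycle V E c \<longleftrightarrow>
     3 \<le> length c \<and> set c \<subseteq> V \<and> distinct c \<and>
     successively (\<lambda>x y. {x, y} \<in> E) c \<and> {last c, hd c} \<in> E"

definition acyclic_graph :: "'a set \<Rightarrow> 'a set set \<Rightarrow> bool" where
  "acyclic_graph V E \<longleftrightarrow> (\<nexists>c. graph_cycle V E c)"

definition tree_graph :: "'a set \<Rightarrow> 'a set set \<Rightarrow> bool" where
  "tree_graph V E \<longleftrightarrow>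
     simple_graph V E \<and> V \<noteq> {} \<and> connected_graph V E \<and> acyclic_graph V E"

text \<open>Degrees are extended natural numbers: all infinite cardinalities become \<open>\<infinity>\<close>.\<close>

definition graph_degree :: "'a set \<Rightarrow> 'a set set \<Rightarrow> 'a \<Rightarrow> enat" where
  "graph_degree V E v =
     (if finite {u \<in> V. {u, v} \<in> E} then enat (card {u \<in> V. {u, v} \<in> E}) else \<infinity>)"

definition rayless :: "'a set \<Rightarrow> 'a set set \<Rightarrow> bool" where
  "rayless V E \<longleftrightarrow>
     (\<nexists>x :: nat \<Rightarrow> 'a. inj x \<and> range x \<subseteq> V \<and> (\<forall>n. {x n, x (Suc n)} \<in> E))"

definition nondegenerate_labeling :: "'a set set \<Rightarrow> ('a \<Rightarrow> real) \<Rightarrow> bool" where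
  "nondegenerate_labeling E l \<longleftrightarrow> (\<forall>u v. {u, v} \<in> E \<longrightarrow> max (l u) (l v) > 0)"

text \<open>
  The value \<open>0\<close> outside \<open>V\<close> is immaterial; it is chosen because the locale \<^locale>\<open>Metric_space\<close>
  requires the distance to be nonnegative and symmetric on the whole type.
\<close>

definition label_dist :: "'a set \<Rightarrow> 'a set set \<Rightarrow> ('a \<Rightarrow> real) \<Rightarrow> 'a \<Rightarrow> 'a \<Rightarrow> real" where
  "label_dist V E l u v =
     (if u \<in> V \<and> v \<in> V \<and> u \<noteq> v then Max (l ` set (THE p. graph_path V E u p v)) else 0)"

end

theory Submission
  imports Defs
begin

text \<open>
  Compactness is used in its Bolzano--Weierstrass form. Infinitely many vertices of label at least
  \<open>\<epsilon>\<close>, or infinitely many neighbours of a vertex of positive label, form an infinite uniformly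
  separated set, which has no limit point. If \<open>a\<close> were a limit point of a ray \<open>x\<close>, let \<open>x k\<close> be the
  first vertex of the ray on the path from \<open>a\<close> to \<open>x 0\<close>; the path from \<open>a\<close> to any later \<open>x n\<close> uses
  the edge from \<open>x k\<close> to \<open>x (k + 1)\<close>, whose larger label is positive, so only finitely many ray
  vertices come close to \<open>a\<close>.

  Conversely, root the tree and let \<open>S\<close> be an infinite vertex set. Since there is no ray, there is
  a vertex \<open>v\<close> whose branch contains infinitely many points of \<open>S\<close> while the branch of each child
  of \<open>v\<close> contains only finitely many. Hence infinitely many child branches meet \<open>S\<close>, so \<open>l v = 0\<close>
  by the degree condition, and all but finitely many of these branches have labels below \<open>\<epsilon>\<close>.
  Thus \<open>v\<close> is a limit point of \<open>S\<close>.
\<close>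

section \<open>Cutting, joining and reversing paths\<close>

lemma graph_path_split:
  assumes "graph_path V E u (p @ x # q) v"
  shows "graph_path V E u (p @ [x]) x" "graph_path V E x (x # q) v" "set p \<inter> set (x # q) = {}"
  using assms unfolding graph_path_def
  by (auto simp: successively_append_iff successively_Cons hd_append split: if_splits)

lemma graph_path_join:
  assumes "graph_path V E u (p @ [x]) x" "graph_path V E x (x # q) v" "set p \<inter> set (x # q) = {}"
  shows "graph_path V E u (p @ x # q) v"
  using assms unfolding graph_path_def
  by (auto simp: successively_append_iff successively_Cons hd_append split: if_splits)

lemma graph_path_rev:
  assumes "graph_path V E u p v"
  shows "graph_path V E v (rev p) u"
  using assms unfolding graph_path_def
  by (auto simp: hd_rev last_rev insert_commute)

text \<open>Following \<open>p\<close> to its first vertex on \<open>q\<close> and then continuing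
  along \<open>q\<close> repeats no vertex. Since no new vertices appear, maxima of labels along
  \<open>r\<close> are controlled by those along \<open>p\<close> and \<open>q\<close>; this is the
  source of the strong triangle inequality.\<close>

lemma graph_path_merge:
  assumes p: "graph_path V E u p v" and q: "graph_path V E v q w"
  obtains r where "graph_path V E u r w" "set r \<subseteq> set p \<union> set q"
proof -
  have "\<exists>x\<in>set p. x \<in> set q"
    using p q unfolding graph_path_def by (metis hd_in_set last_in_set)
  then obtain p1 x p2 where px: "p = p1 @ x # p2" "x \<in> set q" "\<forall>y\<in>set p1. y \<notin> set q"
    using split_list_first_prop[of p "\<lambda>x. x \<in> set q"] by blast
  then obtain q1 q2 where qx: "q = q1 @ x # q2"
    by (meson split_list)
  have "graph_path V E u (p1 @ x # q2) w"
    using graph_path_split[OF p[unfolded px(1)]] graph_path_split[OF q[unfolded qx]] px(3) qx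
    by - (rule graph_path_join, auto)
  then show ?thesis
    by (rule that) (auto simp: px(1) qx)
qed

lemma graph_path_ray_segment:
  fixes x :: "nat \<Rightarrow> 'a"
  assumes "inj x" "range x \<subseteq> V" "\<And>n. {x n, x (Suc n)} \<in> E" "m \<le> n"
  shows "graph_path V E (x m) (map x [m..<Suc n]) (x n)"
proof -
  have "successively (\<lambda>a b. {a, b} \<in> E) (map x [m..<k])" for k
    using assms(3) by (auto simp: successively_conv_nth)
  moreover have "distinct (map x [m..<Suc n])"
    using assms(1) by (auto simp: distinct_map inj_on_def simp del: upt_Suc)
  moreover have "hd (map x [m..<Suc n]) = x m"
    using assms(4) by (simp add: hd_map del: upt_Suc)
  ultimately show ?thesis
    using assms(2,4) unfolding graph_path_def by (auto simp del: upt_Suc simp: last_map)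
qed

section \<open>Unique paths in trees and the label distance\<close>

locale tree_locale =
  fixes V :: "'a set" and E :: "'a set set"
  assumes tree: "tree_graph V E"
begin

lemma edgeD:
  assumes "{u, v} \<in> E"
  shows "u \<in> V" "v \<in> V" "u \<noteq> v"
  using assms tree unfolding tree_graph_def simple_graph_def by fastforce+

lemma path_exists:
  assumes "u \<in> V" "v \<in> V"
  obtains p where "graph_path V E u p v"
  using assms tree unfolding tree_graph_def connected_graph_def by blast

text \<open>Two paths that diverge right after \<open>u\<close> meet again, at \<open>v\<close> at
  the latest. Following one to the first meeting point and returning along the other closes a cycle
  through \<open>u\<close>.\<close>

lemma path_unique:
  assumes "graph_path V E u p v" "graph_path V E u q v"
  shows "p = q"
  using assms
proof (induction p arbitrary: u q)
  case Nil
  then show ?case by (simp add: graph_path_def)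
next
  case (Cons u' p)
  have [simp]: "u' = u" using Cons.prems(1) by (simp add: graph_path_def)
  obtain q' where q: "q = u # q'"
    using Cons.prems(2) unfolding graph_path_def by (cases q) auto
  show ?case
  proof (cases "u = v")
    case True
    then have "p = []" "q' = []"
      using Cons.prems last_in_set[of p] last_in_set[of q'] unfolding q graph_path_def
      by (auto split: if_splits)
    then show ?thesis by (simp add: q)
  next
    case False
    then have ne: "p \<noteq> []" "q' \<noteq> []" and last: "last p = v" "last q' = v"
      using Cons.prems unfolding q graph_path_def by (auto split: if_splits)
    then have sub: "graph_path V E (hd p) p v" "graph_path V E (hd q') q' v"
      and edges: "{u, hd p} \<in> E" "{u, hd q'} \<in> E"
      and notin: "u \<notin> set p" "u \<notin> set q'" and "u \<in> V"
      using Cons.prems unfolding q graph_path_def by (auto simp: successively_Cons)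
    have "hd p = hd q'"
    proof (rule ccontr)
      assume neq: "hd p \<noteq> hd q'"
      have "\<exists>x\<in>set p. x \<in> set q'"
        using ne last by (metis last_in_set)
      then obtain p1 w p2 where pw: "p = p1 @ w # p2" "w \<in> set q'" "\<forall>y\<in>set p1. y \<notin> set q'"
        using split_list_first_prop[of p "\<lambda>x. x \<in> set q'"] by blast
      then obtain q1 q2 where qw: "q' = q1 @ w # q2"
        by (meson split_list)
      have p1: "graph_path V E (hd p) (p1 @ [w]) w" and q1: "graph_path V E (hd q') (q1 @ [w]) w"
        using graph_path_split(1) sub pw(1) qw by metis+
      have r1: "graph_path V E w (w # rev q1) (hd q')"
        using graph_path_rev[OF q1] by simp
      let ?c = "u # p1 @ w # rev q1"
      \<comment> \<open>If both were empty, \<open>w\<close> would be the head of both tails.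
        Excluding this gives \<open>?c\<close> the third vertex that a cycle needs.\<close>
      have "p1 \<noteq> [] \<or> q1 \<noteq> []"
        using neq pw(1) qw by auto
      then have "3 \<le> length ?c"
        by (cases p1; cases q1) auto
      moreover have path: "graph_path V E (hd p) (p1 @ w # rev q1) (hd q')"
        using graph_path_split(3)[OF sub(1)[unfolded pw(1)]] pw(3) qw
        by (intro graph_path_join[OF p1 r1]) auto
      moreover have "u \<notin> set (p1 @ w # rev q1)"
        using notin pw(1) qw by auto
      ultimately have "graph_cycle V E ?c"
        using edges \<open>u \<in> V\<close> unfolding graph_cycle_def graph_path_def
        by (auto simp: successively_Cons insert_commute)
      then show False
        using tree unfolding tree_graph_def acyclic_graph_def by blast
    qed
    then have "p = q'"
      using Cons.IH sub by metis
    then show ?thesis by (simp add: q)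
  qed
qed

lemma label_dist_eq:
  assumes "graph_path V E u p v" "u \<noteq> v"
  shows "label_dist V E l u v = Max (l ` set p)"
proof -
  have "(THE p. graph_path V E u p v) = p"
    using assms(1) path_unique by blast
  moreover have "u \<in> V" "v \<in> V"
    using assms(1) unfolding graph_path_def by (metis hd_in_set last_in_set subsetD)+
  ultimately show ?thesis
    using assms(2) by (simp add: label_dist_def)
qed

lemma label_le_dist:
  assumes "graph_path V E u p v" "u \<noteq> v" "w \<in> set p"
  shows "l w \<le> label_dist V E l u v"
  using label_dist_eq[OF assms(1,2)] assms(3) by simp

lemma end_labels_le_dist:
  assumes "u \<in> V" "v \<in> V" "u \<noteq> v"
  shows "l u \<le> label_dist V E l u v" "l v \<le> label_dist V E l u v"
proof -
  obtain p where p: "graph_path V E u p v" using path_exists assms by blast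
  then have "u \<in> set p" "v \<in> set p"
    unfolding graph_path_def by (metis hd_in_set last_in_set)+
  then show "l u \<le> label_dist V E l u v" "l v \<le> label_dist V E l u v"
    using label_le_dist p assms(3) by metis+
qed

lemma label_dist_attained:
  assumes "graph_path V E u p v" "u \<noteq> v"
  obtains w where "w \<in> set p" "label_dist V E l u v = l w"
proof -
  have "Max (l ` set p) \<in> l ` set p"
    using assms(1) by (intro Max_in) (auto simp: graph_path_def)
  then show ?thesis
    using that label_dist_eq[OF assms] by auto
qed

end

section \<open>The ultrametric of a non-degenerate labeling\<close>

locale labeled_tree = tree_locale +
  fixes l :: "'a \<Rightarrow> real"
  assumes label_nonneg: "v \<in> V \<Longrightarrow> 0 \<le> l v"
    and nondegenerate: "nondegenerate_labeling E l"
begin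

abbreviation d :: "'a \<Rightarrow> 'a \<Rightarrow> real" where "d \<equiv> label_dist V E l"

text \<open>A path between distinct vertices contains an edge, and one end of that edge has positive
  label.\<close>

lemma label_dist_pos:
  assumes "u \<in> V" "v \<in> V" "u \<noteq> v"
  shows "0 < d u v"
proof -
  obtain p where p: "graph_path V E u p v" using path_exists assms by blast
  then obtain a b r where r: "p = a # b # r"
    using assms(3) unfolding graph_path_def by (metis hd_Cons_tl last_ConsL list.sel(1))
  then have "{a, b} \<in> E"
    using p by (auto simp: graph_path_def)
  then have "max (l a) (l b) > 0"
    using nondegenerate unfolding nondegenerate_labeling_def by blast
  moreover have "l a \<le> d u v" "l b \<le> d u v"
    using label_le_dist[OF p assms(3)] r by auto
  ultimately show ?thesis by linarith
qed

lemma label_dist_self [simp]: "d u u = 0"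
  by (simp add: label_dist_def)

lemma label_dist_nonneg: "0 \<le> d u v"
  using label_dist_pos[of u v] by (cases "u \<in> V \<and> v \<in> V \<and> u \<noteq> v") (auto simp: label_dist_def)

lemma label_dist_commute: "d u v = d v u"
proof (cases "u \<in> V \<and> v \<in> V \<and> u \<noteq> v")
  case True
  then obtain p where p: "graph_path V E u p v" using path_exists by blast
  then show ?thesis
    using label_dist_eq[OF p] label_dist_eq[OF graph_path_rev[OF p]] True by (metis set_rev)
qed (auto simp: label_dist_def)

lemma label_dist_ultra:
  assumes "u \<in> V" "v \<in> V" "w \<in> V"
  shows "d u w \<le> max (d u v) (d v w)"
proof (cases "u = v \<or> v = w \<or> u = w")
  case True
  then show ?thesis using label_dist_nonneg[of u v] label_dist_nonneg[of v w] by auto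
next
  case False
  obtain p q where p: "graph_path V E u p v" and q: "graph_path V E v q w"
    using path_exists assms by metis
  obtain r where r: "graph_path V E u r w" "set r \<subseteq> set p \<union> set q"
    using graph_path_merge[OF p q] .
  obtain z where "z \<in> set r" "d u w = l z"
    using label_dist_attained r(1) False by blast
  moreover have "l z \<le> d u v" if "z \<in> set p"
    using label_le_dist[OF p] that False by blast
  moreover have "l z \<le> d v w" if "z \<in> set q"
    using label_le_dist[OF q] that False by blast
  ultimately show ?thesis using r(2) by fastforce
qed

sublocale Metric_space V d
proof
  show "d x z \<le> d x y + d y z" if "x \<in> V" "y \<in> V" "z \<in> V" for x y z
    using label_dist_ultra[OF that] label_dist_nonneg[of x y] label_dist_nonneg[of y z] by linarith
  show "d x y = 0 \<longleftrightarrow> x = y" if "x \<in> V" "y \<in> V" for x y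
    using label_dist_pos[OF that] by (cases "x = y") auto
qed (fact label_dist_nonneg label_dist_commute)+

section \<open>Consequences of compactness\<close>

lemma compact_imp_finite_separated:
  assumes "compact_space mtopology" "S \<subseteq> V" "0 < c"
    and sep: "\<And>x y. x \<in> S \<Longrightarrow> y \<in> S \<Longrightarrow> x \<noteq> y \<Longrightarrow> c \<le> d x y"
  shows "finite S"
proof (rule ccontr)
  assume "infinite S"
  then obtain a where "a \<in> mtopology derived_set_of S"
    using assms(1,2) unfolding compact_space_eq_Bolzano_Weierstrass by blast
  then have a: "a \<in> V" and lim: "\<And>r. 0 < r \<Longrightarrow> \<exists>y\<in>S. y \<noteq> a \<and> y \<in> mball a r"
    unfolding metric_derived_set_of by auto
  obtain y where y: "y \<in> S" "y \<noteq> a" "y \<in> V" "d a y < c"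
    using lim[OF assms(3)] by auto
  then have "0 < d a y" using a label_dist_pos by auto
  \<comment> \<open>Using \<open>d a y\<close> as the second radius forces \<open>z\<close> to
    differ from \<open>y\<close>. Both lie within \<open>c\<close> of \<open>a\<close>, hence of
    each other by the ultrametric inequality.\<close>
  then obtain z where z: "z \<in> S" "z \<noteq> a" "z \<in> V" "d a z < d a y"
    using lim by force
  have "d y z < c"
    using label_dist_ultra[of y a z] a y z label_dist_commute[of a y] by simp
  then show False using sep[of y z] y z by force
qed

lemma compact_imp_rayless:
  assumes compact: "compact_space mtopology"
  shows "rayless V E"
  unfolding rayless_def
proof (intro notI, elim exE conjE)
  fix x :: "nat \<Rightarrow> 'a"
  assume ray: "inj x" "range x \<subseteq> V" "\<forall>n. {x n, x (Suc n)} \<in> E"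
  have "infinite (range x)" using ray(1) by (simp add: finite_image_iff)
  then obtain a where "a \<in> mtopology derived_set_of (range x)"
    using compact ray(2) unfolding compact_space_eq_Bolzano_Weierstrass by blast
  then have a: "a \<in> V" and lim: "\<And>r. 0 < r \<Longrightarrow> \<exists>n. x n \<noteq> a \<and> d a (x n) < r"
    unfolding metric_derived_set_of by fastforce+
  obtain p where p: "graph_path V E a p (x 0)"
    using path_exists[OF a] ray(2) by (meson rangeI subsetD)
  then have "x 0 \<in> set p"
    unfolding graph_path_def by (metis last_in_set)
  then have "\<exists>y\<in>set p. y \<in> range x"
    by blast
  then obtain p1 y p2 where py: "p = p1 @ y # p2" "y \<in> range x" "\<forall>z\<in>set p1. z \<notin> range x"
    using split_list_first_prop[of p "\<lambda>y. y \<in> range x"] by blast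
  then obtain k where k: "y = x k" by blast
  define c where "c = max (l (x k)) (l (x (Suc k)))"
  have "0 < c"
    using ray(3) nondegenerate unfolding c_def nondegenerate_labeling_def by blast
  have far: "c \<le> d a (x n)" if "k < n" "x n \<noteq> a" for n
  proof -
    have "map x [k..<Suc n] = x k # map x [Suc k..<Suc n]"
      using that(1) by (subst upt_conv_Cons) (auto simp del: upt_Suc)
    moreover have "graph_path V E (x k) (map x [k..<Suc n]) (x n)"
      using graph_path_ray_segment ray that(1) by (metis less_imp_le)
    \<comment> \<open>The pieces are disjoint because \<open>p1\<close> avoids the ray;
      \<open>k < n\<close> ensures that \<open>x (Suc k)\<close> is on the path as well.\<close>
    ultimately have "graph_path V E a (p1 @ x k # map x [Suc k..<Suc n]) (x n)"
      using graph_path_split(1)[OF p[unfolded py(1)]] py(3) unfolding k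
      by - (rule graph_path_join, auto simp del: upt_Suc)
    from label_le_dist[OF this, of "x k" l] label_le_dist[OF this, of "x (Suc k)" l]
    show ?thesis using that unfolding c_def by (auto simp del: upt_Suc)
  qed
  \<comment> \<open>This radius excludes the later ray vertices through \<open>c\<close> and the
    first \<open>k + 1\<close> through their own distances. The point \<open>a\<close> is removed
    because its distance 0 would spoil positivity.\<close>
  define r where "r = Min (insert c (d a ` (x ` {..k} - {a})))"
  have "0 < d a (x i)" if "x i \<noteq> a" for i
    using label_dist_pos[OF a, of "x i"] ray(2) that by auto
  then have "0 < r"
    unfolding r_def using \<open>0 < c\<close> by (subst Min_gr_iff) auto
  then obtain n where n: "x n \<noteq> a" "d a (x n) < r" using lim by blast
  have "r \<le> d a (x n)" if "n \<le> k"
    unfolding r_def using that n(1) by (intro Min_le) auto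
  moreover have "r \<le> c" unfolding r_def by simp
  ultimately show False using n far[of n] by (cases "n \<le> k") auto
qed

text \<open>The path between two neighbours of \<open>v\<close> passes through \<open>v\<close>, so
  the neighbours are \<open>l v\<close>-separated.\<close>

lemma compact_imp_finite_degree:
  assumes compact: "compact_space mtopology" and v: "v \<in> V" "0 < l v"
  shows "finite {u \<in> V. {u, v} \<in> E}"
proof (rule compact_imp_finite_separated[OF compact _ v(2)])
  fix x y assume xy: "x \<in> {u \<in> V. {u, v} \<in> E}" "y \<in> {u \<in> V. {u, v} \<in> E}" "x \<noteq> y"
  then have "graph_path V E x [x, v, y] y"
    using v edgeD(3) unfolding graph_path_def by (auto simp: insert_commute)
  then show "l v \<le> d x y"
    using label_le_dist xy(3) by fastforce
qed auto

section \<open>Limit points in rayless trees\<close>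

lemma limit_point_exists:
  assumes rayless: "rayless V E"
    and fin: "\<And>e. 0 < e \<Longrightarrow> finite {v \<in> V. e \<le> l v}"
    and deg: "\<And>v. v \<in> V \<Longrightarrow> 0 < l v \<Longrightarrow> finite {u \<in> V. {u, v} \<in> E}"
    and S: "S \<subseteq> V" "infinite S"
  shows "mtopology derived_set_of S \<noteq> {}"
proof -
  obtain root where root: "root \<in> V" using tree by (auto simp: tree_graph_def)
  have "\<forall>v\<in>V. \<exists>p. graph_path V E root p v"
    using path_exists[OF root] by metis
  then obtain P where P: "\<And>v. v \<in> V \<Longrightarrow> graph_path V E root (P v) v"
    by metis
  \<comment> \<open>By uniqueness, an initial segment of a root path is again a root path. Thus
    \<open>w \<in> set (P x)\<close> says that \<open>w\<close> is \<open>x\<close> or an ancestor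
    of \<open>x\<close>, and \<open>B v\<close> below is the part of \<open>S\<close> in the branch
    at \<open>v\<close>.\<close>
  have P_prefix: "w \<in> V \<and> P w = p @ [w]" if "P x = p @ w # q" "x \<in> V" for x p w q
  proof -
    have "w \<in> V" "graph_path V E root (p @ [w]) w"
      using graph_path_split(1)[OF P[OF that(2), unfolded that(1)]]
      by (auto simp: graph_path_def)
    then show ?thesis using P path_unique by blast
  qed
  define child where "child v c \<longleftrightarrow> c \<in> V \<and> P c = P v @ [c]" for v c
  define B where "B v = {x \<in> S. v \<in> set (P x)}" for v
  have child_edge: "{v, c} \<in> E" if "v \<in> V" "child v c" for v c
    using P[of c] P[of v] that unfolding child_def graph_path_def
    by (auto simp: successively_append_iff)
  have branch: "\<exists>p c q. P x = p @ v # c # q \<and> P v = p @ [v] \<and> child v c"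
    if x: "x \<in> B v" "x \<noteq> v" for v x
  proof -
    have "x \<in> V" using x(1) S(1) by (auto simp: B_def)
    obtain p q where pq: "P x = p @ v # q"
      using x(1) by (auto simp: B_def dest: split_list)
    have "last (P x) = x" using P[OF \<open>x \<in> V\<close>] by (simp add: graph_path_def)
    then obtain c q' where q: "q = c # q'"
      using x(2) pq by (cases q) auto
    have "P v = p @ [v]" using P_prefix[OF pq \<open>x \<in> V\<close>] by simp
    moreover have "c \<in> V \<and> P c = p @ [v, c]"
      using P_prefix[of x "p @ [v]" c q'] \<open>x \<in> V\<close> pq q by simp
    ultimately show ?thesis using pq q unfolding child_def by auto
  qed
  have "\<exists>v\<in>V. infinite (B v) \<and> (\<forall>c. child v c \<longrightarrow> finite (B c))"
  proof (rule ccontr)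
    assume "\<not> ?thesis"
    \<comment> \<open>Otherwise one can descend forever through infinite branches. Depth grows by
      one at each step, so the chosen vertices are distinct and form a ray.\<close>
    then have step: "\<exists>c. (c \<in> V \<and> infinite (B c)) \<and> child v c" if "v \<in> V \<and> infinite (B v)" for v
      using that by (auto simp: child_def)
    have "root \<in> set (P x)" if "x \<in> V" for x
      using P[OF that] unfolding graph_path_def by (metis hd_in_set)
    then have "B root = S" using S(1) by (auto simp: B_def)
    then have "root \<in> V \<and> infinite (B root)" using root S(2) by simp
    then obtain f where f: "\<And>n. f n \<in> V \<and> infinite (B (f n))" "\<And>n. child (f n) (f (Suc n))"
      using dependent_nat_choice[of "\<lambda>_ v. v \<in> V \<and> infinite (B v)" "\<lambda>_. child"] step by metis
    have "length (P (f n)) = length (P (f 0)) + n" for n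
      using f(2) by (induction n) (auto simp: child_def)
    then have "inj f" by (metis add_left_cancel injI)
    then show False
      using rayless f child_edge unfolding rayless_def by blast
  qed
  then obtain v where v: "v \<in> V" "infinite (B v)" "\<And>c. child v c \<Longrightarrow> finite (B c)"
    by blast
  define C where "C = {c. child v c \<and> B c \<noteq> {}}"
  have "B v \<subseteq> insert v (\<Union>c\<in>C. B c)"
    using branch[of _ v] by (fastforce simp: C_def B_def)
  then have "infinite C"
    using v(2,3) finite_subset[of "B v" "insert v (\<Union>c\<in>C. B c)"] by (auto simp: C_def)
  have "l v = 0"
  proof (rule ccontr)
    assume "l v \<noteq> 0"
    then have "finite {u \<in> V. {u, v} \<in> E}" using deg v(1) label_nonneg by force
    moreover have "C \<subseteq> {u \<in> V. {u, v} \<in> E}"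
      using child_edge[OF v(1)] by (auto simp: C_def child_def insert_commute)
    ultimately show False using \<open>infinite C\<close> finite_subset by blast
  qed
  have "\<exists>y\<in>S. y \<noteq> v \<and> y \<in> mball v e" if "0 < e" for e
  proof -
    \<comment> \<open>Only finitely many vertices lie on root paths to labels of at least
      \<open>e\<close>. A child \<open>c \<in> C\<close> outside this set has a branch whose labels
      are all below \<open>e\<close>.\<close>
    have "finite (\<Union>w\<in>{w \<in> V. e \<le> l w}. set (P w))" using fin[OF that] by blast
    then have "\<not> C \<subseteq> (\<Union>w\<in>{w \<in> V. e \<le> l w}. set (P w))"
      using \<open>infinite C\<close> finite_subset by blast
    then obtain c where c: "c \<in> C" "\<And>w. w \<in> V \<Longrightarrow> e \<le> l w \<Longrightarrow> c \<notin> set (P w)"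
      by blast
    then obtain y where y: "y \<in> B c" by (auto simp: C_def)
    have Pc: "P c = P v @ [c]" "c \<in> V" using c(1) by (auto simp: C_def child_def)
    have y': "y \<in> S" "y \<in> V" using y S(1) by (auto simp: B_def)
    have "c \<notin> set (P v)" using P[OF Pc(2)] Pc(1) by (simp add: graph_path_def)
    then have "y \<noteq> v" using y by (auto simp: B_def)
    obtain p where p: "P v = p @ [v]"
      using P[OF v(1)] unfolding graph_path_def by (metis append_butlast_last_id)
    obtain p' q where "P y = p' @ c # q"
      using y by (auto simp: B_def dest: split_list)
    then have Py: "P y = p @ v # c # q"
      using P_prefix[of y p' c q] y'(2) Pc p by auto
    then have path: "graph_path V E v (v # c # q) y"
      using P[OF y'(2)] graph_path_split(2) by metis
    obtain w where w: "w \<in> set (v # c # q)" "d v y = l w"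
      using label_dist_attained[OF path] \<open>y \<noteq> v\<close> by metis
    \<comment> \<open>Either \<open>w\<close> is \<open>v\<close>, of label 0, or \<open>w\<close>
      lies in the branch at \<open>c\<close>, so that \<open>c\<close> is on
      \<open>P w\<close>.\<close>
    have "l w < e"
    proof (cases "w = v")
      case True
      then show ?thesis using \<open>l v = 0\<close> that by simp
    next
      case False
      then obtain q1 q2 where q12: "c # q = q1 @ w # q2"
        using w(1) by (metis set_ConsD split_list)
      then have "w \<in> V \<and> P w = (p @ v # q1) @ [w]"
        using P_prefix[of y "p @ v # q1" w q2] y'(2) Py by simp
      moreover have "c \<in> set (q1 @ [w])" using q12 by (cases q1) auto
      ultimately show ?thesis using c(2)[of w] by fastforce
    qed
    then show ?thesis
      using w(2) y' v(1) \<open>y \<noteq> v\<close> by auto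
  qed
  then have "v \<in> mtopology derived_set_of S"
    using v(1) unfolding metric_derived_set_of by auto
  then show ?thesis by blast
qed

end

theorem theorem4p20:
  fixes V :: "'a set" and E :: "'a set set" and l :: "'a \<Rightarrow> real"
  assumes "tree_graph V E"
    and "\<forall>v\<in>V. 0 \<le> l v"
    and "nondegenerate_labeling E l"
  shows "compact_space (Metric_space.mtopology V (label_dist V E l)) \<longleftrightarrow>
    rayless V E \<and>
    (\<forall>\<epsilon>>0. finite {v \<in> V. \<epsilon> \<le> l v}) \<and>
    (\<forall>v\<in>V. 0 < l v \<longrightarrow> graph_degree V E v < \<infinity>)"
proof -
  interpret labeled_tree V E l
    using assms by unfold_locales auto
  have degree: "graph_degree V E v < \<infinity> \<longleftrightarrow> finite {u \<in> V. {u, v} \<in> E}" for v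
    by (simp add: graph_degree_def)
  have level: "finite {v \<in> V. e \<le> l v}" if "compact_space mtopology" "0 < e" for e
  proof (rule compact_imp_finite_separated[OF that(1) _ that(2)])
    show "e \<le> d x y" if "x \<in> {v \<in> V. e \<le> l v}" "y \<in> {v \<in> V. e \<le> l v}" "x \<noteq> y" for x y
      using end_labels_le_dist(1)[of x y l] that by auto
  qed auto
  show ?thesis
  proof (intro iffI conjI allI impI ballI)
    assume "rayless V E \<and> (\<forall>\<epsilon>>0. finite {v \<in> V. \<epsilon> \<le> l v}) \<and>
      (\<forall>v\<in>V. 0 < l v \<longrightarrow> graph_degree V E v < \<infinity>)"
    then show "compact_space mtopology"
      using limit_point_exists unfolding compact_space_eq_Bolzano_Weierstrass degree by blast
  qed (use compact_imp_rayless compact_imp_finite_degree level degree in blast)+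
qed

end
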